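(* Let $\epsilon>0$, and suppose $m$ inexact iterations of left-preconditioned rational Krylov GMRES (LRK-GMRES, see context) have been performed for the shifted linear system $(\mathbf A-\mu\mathbf B)\mathbf y=\mathbf d$ with $\mathbf A,\mathbf B\in\mathbb C^{N\times N}$, initial shift $\sigma_0$ and shifts $\sigma_1,\dots,\sigma_m$. Let $\mathbf r_m=\mathbf d-(\mathbf A-\mu\mathbf B)\mathbf y_m$ be the true residual and $\tilde{\mathbf r}^\sigma_m$ the computed residual. If the inner residuals satisfy $$\|\mathbf p_k\|\le\frac{1}{|\mu-\sigma_0|}\,\frac{\mathrm{sval}_{\min}(\underline K_m-\mu\underline H_m)}{m}\,\frac{\epsilon}{\|\tilde{\mathbf r}^\sigma_{k-1}\|},\qquad k=1,\dots,m,$$ then $$\|\mathbf r_m\|\le\|(\mathbf A-\sigma_0\mathbf B)\tilde{\mathbf r}^\sigma_m\|+\epsilon .$$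
   Context: $\|\cdot\|$ is the Euclidean norm and $\mathrm{sval}_{\min}$ the smallest singular value. $\mathbf A-\sigma_0\mathbf B$ is invertible, and the quantities in denominators ($\mu-\sigma_0$ and $\|\tilde{\mathbf r}^\sigma_{k-1}\|$, $k=1,\dots,m$) are nonzero. Inexact LRK-GMRES: let $\hat{\mathbf d}=(\mathbf A-\sigma_0\mathbf B)^{-1}\mathbf d$ (computed exactly), $\hat\beta=\|\hat{\mathbf d}\|\ne0$, $\mathbf v_1=\hat{\mathbf d}/\hat\beta$. In iteration $k=1,\dots,m$ one picks $t_k\in\mathbb C^k$, sets $\mathbf v_{t,k}=\mathbf V_kt_k$ with $\mathbf V_k=[\mathbf v_1\cdots\mathbf v_k]$, and computes an approximate solution $\mathbf w_k$ of $(\mathbf A-\sigma_k\mathbf B)\mathbf w_k=\mathbf B\mathbf v_{t,k}$, with inner residual $$\mathbf p_k:=\mathbf B\mathbf v_{t,k}-(\mathbf A-\sigma_k\mathbf B)\mathbf w_k .$$ Then $\mathbf w_k$ is orthonormalized against $\mathbf V_k$ to give $\mathbf v_{k+1}$, so that $\mathbf V_{m+1}=[\mathbf v_1\cdots\mathbf v_{m+1}]$ has orthonormal columns and $[\mathbf w_1\cdots\mathbf w_m]=\mathbf V_{m+1}\underline H_m$ with $\underline H_m\in\mathbb C^{(m+1)\times m}$ upper Hessenberg. Let $\underline T_m\in\mathbb C^{(m+1)\times m}$ be the upper triangular matrix whose $k$-th column is $t_k$ padded with zeros, and $\underline K_m=\underline H_m\,\mathrm{diag}(\sigma_1,\dots,\sigma_m)+\underline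 T_m$. With $\mathbf P_m=[\mathbf p_1\cdots\mathbf p_m]$, this gives $\mathbf A\mathbf V_{m+1}\underline H_m=\mathbf B\mathbf V_{m+1}\underline K_m-\mathbf P_m$. For $k\le m$, $\underline H_k,\underline K_k\in\mathbb C^{(k+1)\times k}$ denote the corresponding matrices after $k$ iterations (leading submatrices of $\underline H_m,\underline K_m$). For $1\le k\le m$ let $y^{\mathrm{red}}_k=\arg\min_{y\in\mathbb C^k}\|\hat\beta e_1-(\underline K_k-\mu\underline H_k)y\|$. The computed residual is $\tilde{\mathbf r}^\sigma_k:=\mathbf V_{k+1}\bigl(\hat\beta e_1-(\underline K_k-\mu\underline H_k)y^{\mathrm{red}}_k\bigr)$ for $k\ge1$, and $\tilde{\mathbf r}^\sigma_0:=\hat\beta\mathbf v_1$. The approximate solution is $\mathbf y_m=\mathbf V_{m+1}(\underline K_m-\sigma_0\underline H_m)y^{\mathrm{red}}_m$. *)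

theory Defs
  imports
    "Jordan_Normal_Form.Schur_Decomposition"
    "Jordan_Normal_Form.Gauss_Jordan_Elimination"
    "HOL-Analysis.L2_Norm"
begin

definition vnorm :: "complex vec \<Rightarrow> real" where
  "vnorm x = L2_set (\<lambda>i. cmod (x $ i)) {..<dim_vec x}"

(* The square roots of the eigenvalues of X^* X.  For a matrix with at least as many rows as
   columns (the only case used here) these are exactly the singular values; for a wide matrix
   the set would contain a spurious 0. *)
definition singular_values :: "complex mat \<Rightarrow> real set" where
  "singular_values X = {s. 0 \<le> s \<and> eigenvalue (mat_adjoint X * X) (complex_of_real (s\<^sup>2))}"

definition sval_min :: "complex mat \<Rightarrow> real" where
  "sval_min X = Min (singular_values X)"

(* Families of vectors such as v, w, t are indexed from 1, whereas matrix and vector entries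
   are indexed from 0: column j of cols_mat N v k is v (j + 1). *)
definition cols_mat :: "nat \<Rightarrow> (nat \<Rightarrow> complex vec) \<Rightarrow> nat \<Rightarrow> complex mat" where
  "cols_mat N v k = mat_of_cols N (map v [1..<k + 1])"

definition leading :: "nat \<Rightarrow> complex mat \<Rightarrow> complex mat" where
  "leading k X = mat (k + 1) k (\<lambda>(i, j). X $$ (i, j))"

definition precond_rhs :: "complex mat \<Rightarrow> complex mat \<Rightarrow> complex \<Rightarrow> complex vec \<Rightarrow> complex vec" where
  "precond_rhs A B \<sigma>\<^sub>0 d = the (mat_inverse (A - \<sigma>\<^sub>0 \<cdot>\<^sub>m B)) *\<^sub>v d"

definition T_mat :: "nat \<Rightarrow> (nat \<Rightarrow> complex vec) \<Rightarrow> complex mat" where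
  "T_mat m t = mat (m + 1) m (\<lambda>(i, j). if i \<le> j then t (j + 1) $ i else 0)"

definition K_mat ::
  "nat \<Rightarrow> (nat \<Rightarrow> complex) \<Rightarrow> (nat \<Rightarrow> complex vec) \<Rightarrow> complex mat \<Rightarrow> complex mat" where
  "K_mat m \<sigma> t H = H * mat_diag m (\<lambda>j. \<sigma> (j + 1)) + T_mat m t"

definition inner_residual ::
  "nat \<Rightarrow> complex mat \<Rightarrow> complex mat \<Rightarrow> (nat \<Rightarrow> complex) \<Rightarrow> (nat \<Rightarrow> complex vec) \<Rightarrow>
    (nat \<Rightarrow> complex vec) \<Rightarrow> (nat \<Rightarrow> complex vec) \<Rightarrow> nat \<Rightarrow> complex vec" where
  "inner_residual N A B \<sigma> v t w k =
     B *\<^sub>v (cols_mat N v k *\<^sub>v t k) - (A - \<sigma> k \<cdot>\<^sub>m B) *\<^sub>v w k"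

(* The vectors w k are arbitrary: as inexact inner solutions they enter only through
   inner_residual. Orthonormalization is recorded by the decomposition it produces; the
   normalization of the subdiagonal entries of H (e.g. real positive) is left open. *)
definition inexact_LRK ::
  "nat \<Rightarrow> nat \<Rightarrow> complex mat \<Rightarrow> complex mat \<Rightarrow> complex vec \<Rightarrow> (nat \<Rightarrow> complex) \<Rightarrow>
    (nat \<Rightarrow> complex vec) \<Rightarrow> (nat \<Rightarrow> complex vec) \<Rightarrow> (nat \<Rightarrow> complex vec) \<Rightarrow> complex mat \<Rightarrow> bool" where
  "inexact_LRK N m A B d \<sigma> v t w H \<longleftrightarrow>
     (let dh = precond_rhs A B (\<sigma> 0) d; \<beta> = vnorm dh; V = cols_mat N v (m + 1) in
       \<beta> \<noteq> 0 \<and> v 1 = complex_of_real (1 / \<beta>) \<cdot>\<^sub>v dh \<and>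
       (\<forall>k\<in>{1..m + 1}. v k \<in> carrier_vec N) \<and>
       (\<forall>k\<in>{1..m}. t k \<in> carrier_vec k) \<and>
       (\<forall>k\<in>{1..m}. w k \<in> carrier_vec N) \<and>
       mat_adjoint V * V = 1\<^sub>m (m + 1) \<and>
       H \<in> carrier_mat (m + 1) m \<and>
       (\<forall>i<m + 1. \<forall>j<m. j + 1 < i \<longrightarrow> H $$ (i, j) = 0) \<and>
       cols_mat N w m = V * H)"

definition reduced_residual ::
  "real \<Rightarrow> complex mat \<Rightarrow> complex mat \<Rightarrow> complex \<Rightarrow> nat \<Rightarrow> complex vec \<Rightarrow> complex vec" where
  "reduced_residual \<beta> H K \<mu> k y =
     complex_of_real \<beta> \<cdot>\<^sub>v unit_vec (k + 1) 0 - (leading k K - \<mu> \<cdot>\<^sub>m leading k H) *\<^sub>v y"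

definition computed_residual ::
  "nat \<Rightarrow> (nat \<Rightarrow> complex vec) \<Rightarrow> real \<Rightarrow> complex mat \<Rightarrow> complex mat \<Rightarrow> complex \<Rightarrow>
    (nat \<Rightarrow> complex vec) \<Rightarrow> nat \<Rightarrow> complex vec" where
  "computed_residual N v \<beta> H K \<mu> yred k =
     (if k = 0 then complex_of_real \<beta> \<cdot>\<^sub>v v 1
      else cols_mat N v (k + 1) *\<^sub>v reduced_residual \<beta> H K \<mu> k (yred k))"

definition approx_solution ::
  "nat \<Rightarrow> nat \<Rightarrow> (nat \<Rightarrow> complex vec) \<Rightarrow> complex mat \<Rightarrow> complex mat \<Rightarrow> complex \<Rightarrow>
    complex vec \<Rightarrow> complex vec" where
  "approx_solution N m v H K \<sigma>\<^sub>0 y = cols_mat N v (m + 1) *\<^sub>v ((K - \<sigma>\<^sub>0 \<cdot>\<^sub>m H) *\<^sub>v y)"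

end

theory Submission
  imports Defs "HOL-Analysis.Function_Topology"
begin

text \<open>
  Write \<open>S = A - \<sigma> 0 B\<close>, \<open>M = K - \<mu> H\<close>, let \<open>V\<close> have columns \<open>v 1, \<dots>, v (m + 1)\<close> and \<open>P\<close> have columns
  the inner residuals, and let \<open>y\<close> be the final least-squares solution. The perturbed rational Krylov
  relation \<open>A V H = B V K - P\<close> makes the two products \<open>(A - \<mu> B) V (K - \<sigma> 0 H)\<close> and \<open>S V M\<close> agree
  up to the multiple \<open>(\<mu> - \<sigma> 0) P\<close>. Hence the true residual is \<open>S r m + (\<mu> - \<sigma> 0) P y\<close>
  (\<open>true_residual_decomposition\<close>), and the gap between true and computed residual is at most
  \<open>|\<mu> - \<sigma> 0|\<close> times the sum of the products of \<open>|y\<^sub>k|\<close> and the norm of the \<open>k\<close>-th inner residual.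

  The inner residuals may grow as the computed residuals shrink because the entries of \<open>y\<close> decay
  at the same rate: \<open>sval_min M * |y\<^sub>k| \<le> \<parallel>r (k - 1)\<parallel>\<close>. To see this, pad the least-squares solution of
  step \<open>k - 1\<close> with zeros to a vector \<open>x\<close> of length \<open>m\<close>. As \<open>M\<close> is upper Hessenberg, the residual
  \<open>\<beta> e\<^sub>1 - M x\<close> is the reduced residual of step \<open>k - 1\<close> padded with zeros, so its norm is that of
  \<open>r (k - 1)\<close> (\<open>computed_residual_zero_padded\<close>). As \<open>y\<close> minimizes the residual, \<open>M (y - x)\<close> is the
  orthogonal projection of \<open>\<beta> e\<^sub>1 - M x\<close> onto the range of \<open>M\<close> and is no longer than it
  (\<open>vnorm_minimizer_image_le\<close>). The \<open>k\<close>-th entry of \<open>y - x\<close> is \<open>y\<^sub>k\<close>, and \<open>M\<close> stretches every vector by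
  at least \<open>sval_min M\<close> (\<open>sval_min_lower_bound\<close>). The assumed bounds on the inner residuals therefore
  contribute at most \<open>\<epsilon> / m\<close> for each of the \<open>m\<close> iterations.
\<close>

section \<open>The Euclidean norm and the adjoint\<close>

lemma vnorm_nonneg: "0 \<le> vnorm x"
  by (simp add: vnorm_def L2_set_nonneg)

lemma vnorm_sq: "(vnorm x)\<^sup>2 = (\<Sum>i<dim_vec x. (cmod (x $ i))\<^sup>2)"
  by (simp add: vnorm_def L2_set_def sum_nonneg)

lemma vnorm_zero_vec [simp]: "vnorm (0\<^sub>v n) = 0"
  by (simp add: vnorm_def L2_set_def)

lemma vnorm_smult: "vnorm (c \<cdot>\<^sub>v x) = cmod c * vnorm x"
  by (auto simp: vnorm_def norm_mult L2_set_right_distrib intro!: L2_set_cong)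

lemma vnorm_triangle:
  assumes "x \<in> carrier_vec n" "y \<in> carrier_vec n"
  shows "vnorm (x + y) \<le> vnorm x + vnorm y"
proof -
  have "vnorm (x + y) \<le> L2_set (\<lambda>i. cmod (x $ i) + cmod (y $ i)) {..<n}"
    using assms by (auto simp: vnorm_def intro!: L2_set_mono norm_triangle_ineq)
  also have "\<dots> \<le> vnorm x + vnorm y"
    using assms L2_set_triangle_ineq by (auto simp: vnorm_def)
  finally show ?thesis .
qed

lemma vnorm_ge_entry:
  assumes "i < dim_vec x"
  shows "cmod (x $ i) \<le> vnorm x"
  using assms by (auto simp: vnorm_def intro!: member_le_L2_set)

lemma cscalar_prod_self: "x \<bullet>c x = complex_of_real ((vnorm x)\<^sup>2)"
  by (auto simp: vnorm_sq scalar_prod_def atLeast0LessThan simp flip: complex_norm_square intro!: sum.cong)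

lemma vnorm_add_sq:
  assumes "x \<in> carrier_vec n" "y \<in> carrier_vec n"
  shows "(vnorm (x + y))\<^sup>2 = (vnorm x)\<^sup>2 + 2 * Re (x \<bullet>c y) + (vnorm y)\<^sup>2"
proof -
  have *: "(cmod (a + b))\<^sup>2 = (cmod a)\<^sup>2 + 2 * Re (a * cnj b) + (cmod b)\<^sup>2" for a b
    unfolding cmod_power2 by (simp add: power2_eq_square algebra_simps)
  show ?thesis
    using assms
    by (simp add: vnorm_sq scalar_prod_def atLeast0LessThan * sum.distrib sum_distrib_left del: complex_mult_cnj)
qed

text \<open>The first-order optimality condition: near \<open>s = 0\<close> the linear term dominates, so a nonzero \<open>b\<close>
  would make the expression negative for small \<open>s\<close> of the opposite sign. Both variational arguments
  below, for the smallest singular value and for the least-squares solution, use it along a real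
  line; real multiples of the direction are enough because only a real part has to vanish.\<close>

lemma quadratic_nonneg_imp_linear_coeff_zero:
  fixes b e :: real
  assumes "\<And>s. 0 \<le> 2 * s * b + s\<^sup>2 * e"
  shows "b = 0"
proof -
  \<comment> \<open>With step \<open>s = - b / k\<close> the linear term outweighs the quadratic one, as \<open>e < 2 k\<close>.\<close>
  define k where "k = \<bar>e\<bar> + 1"
  have k: "k > 0" "e - 2 * k < 0" by (auto simp: k_def)
  have "0 \<le> (2 * (- b / k) * b + (- b / k)\<^sup>2 * e) * k\<^sup>2"
    by (intro mult_nonneg_nonneg assms) simp
  also have "\<dots> = b\<^sup>2 * (e - 2 * k)"
    using k by (simp add: field_simps power2_eq_square)
  finally have "b\<^sup>2 \<le> 0" using k(2) by (simp add: zero_le_mult_iff)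
  then show ?thesis by simp
qed

lemma mat_adjoint_carrier:
  fixes M :: "complex mat"
  assumes "M \<in> carrier_mat p n"
  shows "mat_adjoint M \<in> carrier_mat n p"
  using assms by (auto simp: mat_adjoint_def)

lemma mat_adjoint_index:
  assumes "M \<in> carrier_mat p n" "i < n" "j < p"
  shows "mat_adjoint M $$ (i, j) = cnj (M $$ (j, i))"
  using assms by (auto simp: mat_adjoint_def mat_of_rows_index)

lemma mat_adjoint_cscalar_prod:
  fixes M :: "complex mat"
  assumes M: "M \<in> carrier_mat p n" and x: "x \<in> carrier_vec p" and y: "y \<in> carrier_vec n"
  shows "(mat_adjoint M *\<^sub>v x) \<bullet>c y = x \<bullet>c (M *\<^sub>v y)"
proof -
  note A = mat_adjoint_carrier[OF M]
  have "(mat_adjoint M *\<^sub>v x) \<bullet>c y = (\<Sum>i<n. (\<Sum>j<p. cnj (M $$ (j, i)) * x $ j) * cnj (y $ i))"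
    using A M x y
    by (auto simp: scalar_prod_def atLeast0LessThan mat_adjoint_index intro!: sum.cong)
  also have "\<dots> = (\<Sum>j<p. \<Sum>i<n. cnj (M $$ (j, i)) * x $ j * cnj (y $ i))"
    unfolding sum_distrib_right by (rule sum.swap)
  also have "\<dots> = x \<bullet>c (M *\<^sub>v y)"
    using M x y
    by (auto simp: scalar_prod_def atLeast0LessThan sum_distrib_left ac_simps intro!: sum.cong)
  finally show ?thesis .
qed

lemma vnorm_isometry:
  assumes V: "V \<in> carrier_mat p n" and VV: "mat_adjoint V * V = 1\<^sub>m n" and x: "x \<in> carrier_vec n"
  shows "vnorm (V *\<^sub>v x) = vnorm x"
proof -
  have "mat_adjoint V *\<^sub>v (V *\<^sub>v x) = x"
    using assoc_mult_mat_vec[OF mat_adjoint_carrier[OF V] V x] VV x by simp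
  then have "x \<bullet>c x = (V *\<^sub>v x) \<bullet>c (V *\<^sub>v x)"
    using mat_adjoint_cscalar_prod[OF V _ x, of "V *\<^sub>v x"] V x by simp
  then have "(vnorm x)\<^sup>2 = (vnorm (V *\<^sub>v x))\<^sup>2"
    unfolding cscalar_prod_self of_real_eq_iff .
  then show ?thesis by (simp add: vnorm_nonneg)
qed

section \<open>The smallest singular value as the smallest stretch\<close>

text \<open>The dimension of the vectors is a term and not a type, so compactness of the unit sphere is taken
  from the product topology on sequences: the sphere is a closed subset of a product of compact
  squares, almost all of them reduced to the single point \<open>0\<close>.\<close>

lemma vnorm_mult_attains_min_on_sphere:
  assumes M: "M \<in> carrier_mat p n" and n: "0 < n"
  obtains z where "z \<in> carrier_vec n" "vnorm z = 1"
    "\<And>x. x \<in> carrier_vec n \<Longrightarrow> vnorm x = 1 \<Longrightarrow> vnorm (M *\<^sub>v z) \<le> vnorm (M *\<^sub>v x)"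
proof -
  define square where "square = (\<lambda>(a, b). Complex a b) ` ({-1..1} \<times> {-1..1})"
  have square: "compact square"
    unfolding square_def split_def
    by (intro compact_continuous_image continuous_intros compact_Times compact_Icc)
  have in_square: "c \<in> square" if "cmod c \<le> 1" for c
    using that abs_Re_le_cmod[of c] abs_Im_le_cmod[of c]
    unfolding square_def by (intro rev_image_eqI[of "(Re c, Im c)"]) auto
  define box where "box = (\<lambda>i. if i < n then square else {0})"
  define S where "S = PiE UNIV box \<inter> {f. (\<Sum>i<n. (cmod (f i))\<^sup>2) = 1}"
  define g where "g = (\<lambda>f :: nat \<Rightarrow> complex. \<Sum>i<p. (cmod (\<Sum>j<n. M $$ (i, j) * f j))\<^sup>2)"
  have sphere: "(vnorm (vec n f))\<^sup>2 = (\<Sum>i<n. (cmod (f i))\<^sup>2)" for f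
    by (simp add: vnorm_sq)
  have image: "(vnorm (M *\<^sub>v vec n f))\<^sup>2 = g f" for f
    using M by (simp add: vnorm_sq g_def scalar_prod_def atLeast0LessThan)
  have "compactin (product_topology (\<lambda>i. euclidean) UNIV) (PiE UNIV box)"
    using square by (subst compactin_PiE) (auto simp: box_def)
  then have "compact (PiE UNIV box)"
    by (simp add: euclidean_product_topology)
  moreover have "closed {f :: nat \<Rightarrow> complex. (\<Sum>i<n. (cmod (f i))\<^sup>2) = 1}"
    by (intro closed_Collect_eq continuous_intros continuous_on_product_coordinates)
  ultimately have "compact S"
    unfolding S_def by (rule compact_Int_closed)
  moreover have "(\<lambda>i. if i = 0 then 1 else 0) \<in> S"
    using n by (auto simp: S_def box_def in_square if_distrib[of cmod] if_distrib[of "\<lambda>x :: real. x\<^sup>2"] cong: if_cong)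
  moreover have "continuous_on S g"
    unfolding g_def by (intro continuous_intros continuous_on_subset[OF continuous_on_product_coordinates]) auto
  ultimately obtain f where f: "f \<in> S" "\<And>h. h \<in> S \<Longrightarrow> g f \<le> g h"
    using continuous_attains_inf[of S g] by blast
  show ?thesis
  proof
    show "vec n f \<in> carrier_vec n" by simp
    show "vnorm (vec n f) = 1"
      using f(1) sphere[of f] vnorm_nonneg[of "vec n f"] by (simp add: S_def power2_eq_1_iff)
  next
    fix x assume x: "x \<in> carrier_vec n" "vnorm x = 1"
    define h where "h = (\<lambda>i. if i < n then x $ i else 0)"
    have xh: "x = vec n h" using x(1) by (auto simp: h_def)
    have "h \<in> S"
      using x sphere[of h] vnorm_ge_entry[of _ x] unfolding xh[symmetric]
      by (auto simp: S_def box_def h_def in_square)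
    then have "(vnorm (M *\<^sub>v vec n f))\<^sup>2 \<le> (vnorm (M *\<^sub>v x))\<^sup>2"
      unfolding xh image by (rule f(2))
    then show "vnorm (M *\<^sub>v vec n f) \<le> vnorm (M *\<^sub>v x)"
      using vnorm_nonneg by (rule power2_le_imp_le)
  qed
qed

lemma finite_singular_values:
  assumes M: "M \<in> carrier_mat p n"
  shows "finite (singular_values M)"
proof -
  let ?G = "mat_adjoint M * M"
  have G: "?G \<in> carrier_mat n n" using M mat_adjoint_carrier[OF M] by simp
  have "char_poly ?G \<noteq> 0" using degree_monic_char_poly[OF G] by auto
  then have "finite {e. eigenvalue ?G e}"
    by (simp add: eigenvalue_root_char_poly[OF G] poly_roots_finite)
  then have "finite ((\<lambda>s. complex_of_real (s\<^sup>2)) -` {e. eigenvalue ?G e} \<inter> {0..})"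
    by (rule finite_vimage_IntI) (auto simp: inj_on_def simp flip: of_real_power)
  then show ?thesis
    by (rule rev_finite_subset) (auto simp: singular_values_def)
qed

text \<open>The quadratic form \<open>\<parallel>M x\<parallel>\<^sup>2 - c\<^sup>2 \<parallel>x\<parallel>\<^sup>2\<close>, where \<open>c = \<parallel>M z\<parallel>\<close>, is nonnegative and vanishes at \<open>z\<close>, so its
  derivative at \<open>z\<close> vanishes in every direction. The direction \<open>h = M\<^sup>* M z - c\<^sup>2 z\<close>, half the gradient
  itself, gives \<open>\<parallel>h\<parallel>\<^sup>2 = 0\<close>: the minimizer is an eigenvector. This replaces the spectral theorem for
  the Hermitian matrix \<open>M\<^sup>* M\<close>.\<close>

lemma min_stretch_is_singular_value:
  assumes M: "M \<in> carrier_mat p n"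
    and z: "z \<in> carrier_vec n" "vnorm z = 1"
    and min: "\<And>x. x \<in> carrier_vec n \<Longrightarrow> vnorm (M *\<^sub>v z) * vnorm x \<le> vnorm (M *\<^sub>v x)"
  shows "vnorm (M *\<^sub>v z) \<in> singular_values M"
proof -
  define c where "c = vnorm (M *\<^sub>v z)"
  let ?G = "mat_adjoint M * M"
  note A = mat_adjoint_carrier[OF M]
  define h where "h = ?G *\<^sub>v z - complex_of_real (c\<^sup>2) \<cdot>\<^sub>v z"
  have G: "?G \<in> carrier_mat n n" using A M by simp
  have Gz: "?G *\<^sub>v z = mat_adjoint M *\<^sub>v (M *\<^sub>v z)"
    using assoc_mult_mat_vec[OF A M z(1)] .
  have Gzc: "?G *\<^sub>v z \<in> carrier_vec n" using G z by simp
  have h: "h \<in> carrier_vec n" unfolding h_def using G z by simp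
  have Mz: "M *\<^sub>v z \<in> carrier_vec p" and Mh: "M *\<^sub>v h \<in> carrier_vec p"
    using M z(1) h by simp_all
  have expand: "(vnorm (x + complex_of_real s \<cdot>\<^sub>v y))\<^sup>2
      = (vnorm x)\<^sup>2 + 2 * s * Re (x \<bullet>c y) + s\<^sup>2 * (vnorm y)\<^sup>2"
    if "x \<in> carrier_vec k" "y \<in> carrier_vec k" for x y s k
    using that by (subst vnorm_add_sq[of _ k])
      (auto simp: vnorm_smult power_mult_distrib conjugate_smult_vec)
  \<comment> \<open>Minimality along the line \<open>z + s h\<close>; the left-hand side is the real part of \<open>h \<bullet>c h\<close>.\<close>
  have "Re ((M *\<^sub>v z) \<bullet>c (M *\<^sub>v h)) - c\<^sup>2 * Re (z \<bullet>c h) = 0"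
  proof (rule quadratic_nonneg_imp_linear_coeff_zero)
    fix s :: real
    let ?x = "z + complex_of_real s \<cdot>\<^sub>v h"
    have "(c * vnorm ?x)\<^sup>2 \<le> (vnorm (M *\<^sub>v ?x))\<^sup>2"
      unfolding c_def using z h by (intro power_mono min mult_nonneg_nonneg vnorm_nonneg) auto
    also have "M *\<^sub>v ?x = M *\<^sub>v z + complex_of_real s \<cdot>\<^sub>v (M *\<^sub>v h)"
      using M z h by (simp add: mult_add_distrib_mat_vec mult_mat_vec)
    finally show "0 \<le> 2 * s * (Re ((M *\<^sub>v z) \<bullet>c (M *\<^sub>v h)) - c\<^sup>2 * Re (z \<bullet>c h))
        + s\<^sup>2 * ((vnorm (M *\<^sub>v h))\<^sup>2 - c\<^sup>2 * (vnorm h)\<^sup>2)"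
      unfolding power_mult_distrib expand[OF z(1) h] expand[OF Mz Mh] z(2) c_def[symmetric]
      by (simp add: algebra_simps)
  qed
  moreover have "h \<bullet>c h = (?G *\<^sub>v z) \<bullet>c h - complex_of_real (c\<^sup>2) * (z \<bullet>c h)"
    using Gzc z h by (subst (1) h_def) (simp add: minus_scalar_prod_distrib[of _ n])
  moreover have "(?G *\<^sub>v z) \<bullet>c h = (M *\<^sub>v z) \<bullet>c (M *\<^sub>v h)"
    unfolding Gz using mat_adjoint_cscalar_prod[OF M Mz h] .
  ultimately have "Re (h \<bullet>c h) = 0" by simp
  then have "h \<bullet>c h = 0" unfolding cscalar_prod_self by simp
  then have h0: "h = 0\<^sub>v n" using h by simp
  have "?G *\<^sub>v z = complex_of_real (c\<^sup>2) \<cdot>\<^sub>v z"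
  proof
    fix i assume "i < dim_vec (complex_of_real (c\<^sup>2) \<cdot>\<^sub>v z)"
    then show "(?G *\<^sub>v z) $ i = (complex_of_real (c\<^sup>2) \<cdot>\<^sub>v z) $ i"
      using arg_cong[OF h0, of "\<lambda>x. x $ i"] z Gzc by (simp add: h_def)
  qed (use A z in simp)
  moreover have "z \<noteq> 0\<^sub>v n" using z(2) by auto
  ultimately have "eigenvector ?G z (complex_of_real (c\<^sup>2))"
    using A z by (simp add: eigenvector_def)
  then show ?thesis
    unfolding c_def[symmetric] singular_values_def eigenvalue_def
    using vnorm_nonneg c_def by blast
qed

text \<open>The minimal stretch is attained, and is itself a singular value, so it is bounded below by the
  smallest one. A column must exist: otherwise the set of singular values is empty and
  its minimum is unspecified.\<close>

lemma sval_min_lower_bound: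
  assumes M: "M \<in> carrier_mat p n" and n: "0 < n"
  shows "0 \<le> sval_min M"
    and "\<And>x. x \<in> carrier_vec n \<Longrightarrow> sval_min M * vnorm x \<le> vnorm (M *\<^sub>v x)"
proof -
  obtain z where z: "z \<in> carrier_vec n" "vnorm z = 1"
    and min: "\<And>x. x \<in> carrier_vec n \<Longrightarrow> vnorm x = 1 \<Longrightarrow> vnorm (M *\<^sub>v z) \<le> vnorm (M *\<^sub>v x)"
    using vnorm_mult_attains_min_on_sphere[OF M n] by blast
  have hom: "vnorm (M *\<^sub>v z) * vnorm x \<le> vnorm (M *\<^sub>v x)" if x: "x \<in> carrier_vec n" for x
  proof (cases "vnorm x = 0")
    case True
    then show ?thesis by (simp add: vnorm_nonneg)
  next
    case False
    define c where "c = complex_of_real (1 / vnorm x)"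
    have c: "cmod c = 1 / vnorm x" using vnorm_nonneg[of x] by (simp add: c_def norm_divide)
    have "vnorm (M *\<^sub>v z) \<le> vnorm (M *\<^sub>v (c \<cdot>\<^sub>v x))"
      using x False by (intro min) (auto simp: vnorm_smult c)
    also have "\<dots> = vnorm (M *\<^sub>v x) / vnorm x"
      using M x by (simp add: mult_mat_vec vnorm_smult c)
    finally show ?thesis
      using False vnorm_nonneg[of x] by (simp add: field_simps)
  qed
  have sv: "vnorm (M *\<^sub>v z) \<in> singular_values M"
    using M z hom by (rule min_stretch_is_singular_value)
  have fin: "finite (singular_values M)" using M by (rule finite_singular_values)
  have "sval_min M \<in> singular_values M"
    unfolding sval_min_def using fin sv by (intro Min_in) auto
  then show "0 \<le> sval_min M" by (simp add: singular_values_def)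
  have le: "sval_min M \<le> vnorm (M *\<^sub>v z)"
    unfolding sval_min_def using fin sv by (intro Min_le)
  show "sval_min M * vnorm x \<le> vnorm (M *\<^sub>v x)" if "x \<in> carrier_vec n" for x
    using mult_right_mono[OF le vnorm_nonneg[of x]] hom[OF that] by linarith
qed

section \<open>Decay of the least-squares coefficients\<close>

text \<open>At a least-squares solution \<open>y\<close> the residual \<open>a = b - M y\<close> is orthogonal to the range of \<open>M\<close>. So
  \<open>b - M x = a + M (y - x)\<close> is an orthogonal sum, and the claim is Pythagoras.\<close>

lemma vnorm_minimizer_image_le:
  assumes M: "M \<in> carrier_mat p n" and b: "b \<in> carrier_vec p"
    and y: "y \<in> carrier_vec n" and x: "x \<in> carrier_vec n"
    and min: "\<And>y'. y' \<in> carrier_vec n \<Longrightarrow> vnorm (b - M *\<^sub>v y) \<le> vnorm (b - M *\<^sub>v y')"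
  shows "vnorm (M *\<^sub>v (y - x)) \<le> vnorm (b - M *\<^sub>v x)"
proof -
  define a where "a = b - M *\<^sub>v y"
  define c where "c = M *\<^sub>v (y - x)"
  have c: "c \<in> carrier_vec p" unfolding c_def using M x y by simp
  have a: "a \<in> carrier_vec p" unfolding a_def using M b y by simp
  have c': "c = M *\<^sub>v y - M *\<^sub>v x"
    unfolding c_def using M x y by (simp add: mult_minus_distrib_mat_vec[OF M])
  have expand: "(vnorm (a + complex_of_real s \<cdot>\<^sub>v c))\<^sup>2
      = (vnorm a)\<^sup>2 + 2 * s * Re (a \<bullet>c c) + s\<^sup>2 * (vnorm c)\<^sup>2" for s
    using a c by (subst vnorm_add_sq[of _ p])
      (auto simp: vnorm_smult power_mult_distrib conjugate_smult_vec)
  have "Re (a \<bullet>c c) = 0"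
  proof (rule quadratic_nonneg_imp_linear_coeff_zero)
    fix s :: real
    \<comment> \<open>The residual of this competitor is \<open>a + s c\<close>, so \<open>s = 0\<close> is a minimum on the line.\<close>
    let ?y = "y - complex_of_real s \<cdot>\<^sub>v (y - x)"
    have "(vnorm a)\<^sup>2 \<le> (vnorm (b - M *\<^sub>v ?y))\<^sup>2"
      unfolding a_def using x y by (intro power_mono min vnorm_nonneg) auto
    also have "M *\<^sub>v ?y = M *\<^sub>v y - complex_of_real s \<cdot>\<^sub>v c"
      unfolding c_def using M x y by (simp add: mult_minus_distrib_mat_vec[OF M] mult_mat_vec)
    also have "b - \<dots> = a + complex_of_real s \<cdot>\<^sub>v c"
      using M a b c unfolding a_def by (intro eq_vecI) auto
    finally show "0 \<le> 2 * s * Re (a \<bullet>c c) + s\<^sup>2 * (vnorm c)\<^sup>2"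
      unfolding expand by simp
  qed
  then have "(vnorm (a + c))\<^sup>2 = (vnorm a)\<^sup>2 + (vnorm c)\<^sup>2"
    using vnorm_add_sq[OF a c] by simp
  moreover have "a + c = b - M *\<^sub>v x"
    unfolding a_def c' using M b x y by (intro eq_vecI) auto
  ultimately have "(vnorm c)\<^sup>2 \<le> (vnorm (b - M *\<^sub>v x))\<^sup>2" by simp
  then show ?thesis unfolding c_def using vnorm_nonneg by (rule power2_le_imp_le)
qed

text \<open>
  A competitor \<open>x\<close> whose \<open>j\<close>-th entry is zero sees \<open>y $ j\<close> as an entry of the difference \<open>y - x\<close>, whose
  norm, up to the factor \<open>sval_min M\<close>, is controlled by the residual of \<open>x\<close>. The earlier iterates,
  padded with zeros, are such competitors.
\<close>

lemma minimizer_entry_bound: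
  assumes M: "M \<in> carrier_mat p n" and b: "b \<in> carrier_vec p"
    and y: "y \<in> carrier_vec n" and x: "x \<in> carrier_vec n"
    and min: "\<And>y'. y' \<in> carrier_vec n \<Longrightarrow> vnorm (b - M *\<^sub>v y) \<le> vnorm (b - M *\<^sub>v y')"
    and j: "j < n" and xj: "x $ j = 0"
  shows "sval_min M * cmod (y $ j) \<le> vnorm (b - M *\<^sub>v x)"
proof -
  have n: "0 < n" using j by simp
  have "cmod (y $ j) \<le> vnorm (y - x)"
    using vnorm_ge_entry[of j "y - x"] x y j xj by simp
  then have "sval_min M * cmod (y $ j) \<le> sval_min M * vnorm (y - x)"
    using sval_min_lower_bound(1)[OF M n] by (rule mult_left_mono)
  also have "\<dots> \<le> vnorm (M *\<^sub>v (y - x))"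
    using sval_min_lower_bound(2)[OF M n] x y by simp
  also have "\<dots> \<le> vnorm (b - M *\<^sub>v x)"
    using M b y x min by (rule vnorm_minimizer_image_le)
  finally show ?thesis .
qed

section \<open>Matrix-vector products\<close>

lemma cols_mat_carrier [simp]: "cols_mat N v k \<in> carrier_mat N k"
  by (rule carrier_matI) (simp_all add: cols_mat_def del: upt_Suc)

lemma dim_cols_mat [simp]: "dim_row (cols_mat N v k) = N" "dim_col (cols_mat N v k) = k"
  using cols_mat_carrier[of N v k] by (auto simp del: cols_mat_carrier)

lemma cols_mat_index:
  assumes "i < N" "j < k"
  shows "cols_mat N v k $$ (i, j) = v (j + 1) $ i"
  using assms by (simp add: cols_mat_def mat_of_cols_index del: upt_Suc)

lemma col_cols_mat:
  assumes "j < k" "v (j + 1) \<in> carrier_vec N"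
  shows "col (cols_mat N v k) j = v (j + 1)"
  using assms by (intro eq_vecI) (auto simp: cols_mat_index)

lemma cols_mat_mult_vec_index:
  assumes "x \<in> carrier_vec k" "i < N"
  shows "(cols_mat N v k *\<^sub>v x) $ i = (\<Sum>j<k. v (j + 1) $ i * x $ j)"
  using assms by (auto simp: scalar_prod_def atLeast0LessThan cols_mat_index intro!: sum.cong)

lemma cols_mat_mult_truncate:
  assumes x: "x \<in> carrier_vec n" and k: "k \<le> n"
    and zero: "\<And>i. k \<le> i \<Longrightarrow> i < n \<Longrightarrow> x $ i = 0"
  shows "cols_mat N v n *\<^sub>v x = cols_mat N v k *\<^sub>v vec k (\<lambda>i. x $ i)"
proof (rule eq_vecI)
  fix i assume "i < dim_vec (cols_mat N v k *\<^sub>v vec k (\<lambda>i. x $ i))"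
  then have i: "i < N" by simp
  have "(\<Sum>j<n. v (j + 1) $ i * x $ j) = (\<Sum>j<k. v (j + 1) $ i * x $ j)"
    using k zero by (intro sum.mono_neutral_right) auto
  then show "(cols_mat N v n *\<^sub>v x) $ i = (cols_mat N v k *\<^sub>v vec k (\<lambda>i. x $ i)) $ i"
    using x i by (simp add: cols_mat_mult_vec_index del: index_mult_mat_vec)
qed simp

text \<open>The triangle inequality for a linear combination of columns. The matrix depends only on the first
  \<open>N\<close> entries of each \<open>p (j + 1)\<close>, and the bound refers to these; for vectors of dimension \<open>N\<close> they
  are \<open>p (j + 1)\<close> itself.\<close>

lemma vnorm_cols_mat_mult_le:
  assumes y: "y \<in> carrier_vec m"
  shows "vnorm (cols_mat N p m *\<^sub>v y) \<le> (\<Sum>j<m. cmod (y $ j) * vnorm (vec N (\<lambda>i. p (j + 1) $ i)))"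
proof -
  have *: "vnorm (vec N (\<lambda>i. \<Sum>j<l. p (j + 1) $ i * y $ j))
      \<le> (\<Sum>j<l. cmod (y $ j) * vnorm (vec N (\<lambda>i. p (j + 1) $ i)))" for l
  proof (induction l)
    case 0
    then show ?case by (simp flip: zero_vec_def)
  next
    case (Suc l)
    let ?u = "vec N (\<lambda>i. \<Sum>j<l. p (j + 1) $ i * y $ j)"
    let ?q = "y $ l \<cdot>\<^sub>v vec N (\<lambda>i. p (l + 1) $ i)"
    have "vec N (\<lambda>i. \<Sum>j<Suc l. p (j + 1) $ i * y $ j) = ?u + ?q"
      by (intro eq_vecI) auto
    also have "vnorm \<dots> \<le> vnorm ?u + vnorm ?q"
      by (rule vnorm_triangle[of _ N]) auto
    finally show ?case using Suc by (simp add: vnorm_smult)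
  qed
  have "cols_mat N p m *\<^sub>v y = vec N (\<lambda>i. \<Sum>j<m. p (j + 1) $ i * y $ j)"
    using y by (intro eq_vecI) (auto simp: cols_mat_mult_vec_index simp del: index_mult_mat_vec)
  then show ?thesis using * by simp
qed

lemma mat_inverse_solves:
  fixes S :: "complex mat"
  assumes S: "S \<in> carrier_mat n n" and inv: "invertible_mat S" and d: "d \<in> carrier_vec n"
  shows "the (mat_inverse S) *\<^sub>v d \<in> carrier_vec n"
    and "S *\<^sub>v (the (mat_inverse S) *\<^sub>v d) = d"
proof -
  obtain R where "S * R = 1\<^sub>m n" "R * S = 1\<^sub>m (dim_row R)"
    using inv S by (auto simp: invertible_mat_def inverts_mat_def)
  moreover from this have "R \<in> carrier_mat n n"
    using S by (metis carrier_matD(2) carrier_matI index_mult_mat(2,3) index_one_mat(2,3))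
  ultimately have "S \<in> Units (ring_mat TYPE(complex) n ())"
    using S by (auto simp: Units_def ring_mat_def)
  then obtain C where C: "mat_inverse S = Some C"
    using mat_inverse(1)[OF S, of "()"] by (cases "mat_inverse S") auto
  from mat_inverse(2)[OF S C] have SC: "S * C = 1\<^sub>m n" and Cc: "C \<in> carrier_mat n n" by auto
  show "the (mat_inverse S) *\<^sub>v d \<in> carrier_vec n" using C Cc d by simp
  show "S *\<^sub>v (the (mat_inverse S) *\<^sub>v d) = d"
    using assoc_mult_mat_vec[OF S Cc d] SC d C by simp
qed

lemma matrix_pencil_mult_vec:
  fixes X Y :: "complex mat"
  assumes "X \<in> carrier_mat a b" "Y \<in> carrier_mat a b" "x \<in> carrier_vec b"
  shows "(X - c \<cdot>\<^sub>m Y) *\<^sub>v x = X *\<^sub>v x - c \<cdot>\<^sub>v (Y *\<^sub>v x)"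
  using assms by (intro eq_vecI)
    (auto simp: minus_mult_distrib_mat_vec[of _ a b] smult_scalar_prod_distrib[of _ b])

section \<open>The inexact rational Krylov relation\<close>

lemma K_mat_carrier:
  assumes "H \<in> carrier_mat (m + 1) m"
  shows "K_mat m \<sigma> t H \<in> carrier_mat (m + 1) m"
  using assms by (simp add: K_mat_def T_mat_def mat_diag_mult_right)

lemma K_mat_index:
  assumes "H \<in> carrier_mat (m + 1) m" "i < m + 1" "j < m"
  shows "K_mat m \<sigma> t H $$ (i, j) = H $$ (i, j) * \<sigma> (j + 1) + (if i \<le> j then t (j + 1) $ i else 0)"
  using assms by (simp add: K_mat_def T_mat_def mat_diag_mult_right)

text \<open>Column by column this is the definition of the inner residual, solved for \<open>A *\<^sub>v w k\<close>: the \<open>k\<close>-th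
  column of \<open>V H\<close> is \<open>w k\<close>, and that of \<open>V K\<close> is \<open>\<sigma> k \<cdot>\<^sub>v w k\<close> plus the continuation vector
  built from \<open>t k\<close>.\<close>

lemma inexact_rational_Krylov_relation:
  assumes A: "A \<in> carrier_mat N N" and B: "B \<in> carrier_mat N N"
    and H: "H \<in> carrier_mat (m + 1) m"
    and t: "\<And>k. k \<in> {1..m} \<Longrightarrow> t k \<in> carrier_vec k"
    and w: "\<And>k. k \<in> {1..m} \<Longrightarrow> w k \<in> carrier_vec N"
    and W: "cols_mat N w m = cols_mat N v (m + 1) * H"
  shows "A * (cols_mat N v (m + 1) * H)
    = B * (cols_mat N v (m + 1) * K_mat m \<sigma> t H) - cols_mat N (inner_residual N A B \<sigma> v t w) m"
proof (rule mat_col_eqI)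
  let ?V = "cols_mat N v (m + 1)" and ?K = "K_mat m \<sigma> t H"
  note K = K_mat_carrier[OF H, of \<sigma> t]
  fix j assume "j < dim_col (B * (?V * ?K) - cols_mat N (inner_residual N A B \<sigma> v t w) m)"
  then have j: "j < m" by simp
  then have tj: "t (j + 1) \<in> carrier_vec (j + 1)" and wj: "w (j + 1) \<in> carrier_vec N"
    using t[of "j + 1"] w[of "j + 1"] by auto
  define x where "x = vec (m + 1) (\<lambda>i. if i \<le> j then t (j + 1) $ i else 0)"
  have x: "x \<in> carrier_vec (m + 1)" by (simp add: x_def)
  define u where "u = cols_mat N v (j + 1) *\<^sub>v t (j + 1)"
  have u: "u \<in> carrier_vec N"
    unfolding u_def by (rule mult_mat_vec_carrier[OF cols_mat_carrier tj])
  have "vec (j + 1) (\<lambda>i. x $ i) = t (j + 1)"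
    using tj j by (intro eq_vecI) (auto simp: x_def)
  then have Vx: "?V *\<^sub>v x = u"
    using cols_mat_mult_truncate[OF x, of "j + 1" N v] j by (simp add: x_def u_def)
  have VH: "?V *\<^sub>v col H j = w (j + 1)"
    using arg_cong[OF W, of "\<lambda>X. col X j"] col_mult2[OF _ H j, of ?V N]
      col_cols_mat[where j = j and v = w, OF j wj]
    by simp
  have "col ?K j = \<sigma> (j + 1) \<cdot>\<^sub>v col H j + x"
    using K H j by (intro eq_vecI) (auto simp: K_mat_index x_def)
  then have "?V *\<^sub>v col ?K j = \<sigma> (j + 1) \<cdot>\<^sub>v w (j + 1) + u"
    using H j x Vx VH by (simp add: mult_add_distrib_mat_vec[of _ N "m + 1"] mult_mat_vec[of _ N "m + 1"])
  then have BVK: "col (B * (?V * ?K)) j = \<sigma> (j + 1) \<cdot>\<^sub>v (B *\<^sub>v w (j + 1)) + B *\<^sub>v u"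
    using col_mult2[OF B mult_carrier_mat[OF cols_mat_carrier K] j] col_mult2[OF _ K j, of ?V N] B wj u
    by (simp add: mult_add_distrib_mat_vec[OF B] mult_mat_vec[OF B])
  have AVH: "col (A * (?V * H)) j = A *\<^sub>v w (j + 1)"
    using col_mult2[OF A mult_carrier_mat[OF cols_mat_carrier H] j] col_mult2[OF _ H j, of ?V N] VH
    by simp
  have p: "inner_residual N A B \<sigma> v t w (j + 1)
      = B *\<^sub>v u - (A *\<^sub>v w (j + 1) - \<sigma> (j + 1) \<cdot>\<^sub>v (B *\<^sub>v w (j + 1)))"
    using A B wj by (simp add: inner_residual_def u_def matrix_pencil_mult_vec[of _ N N])
  show "col (A * (?V * H)) j
      = col (B * (?V * ?K) - cols_mat N (inner_residual N A B \<sigma> v t w) m) j"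
  proof (rule eq_vecI)
    fix i assume "i < dim_vec (col (B * (?V * ?K) - cols_mat N (inner_residual N A B \<sigma> v t w) m) j)"
    then have i: "i < N" by simp
    have "col (B * (?V * ?K) - cols_mat N (inner_residual N A B \<sigma> v t w) m) j $ i
        = col (B * (?V * ?K)) j $ i - inner_residual N A B \<sigma> v t w (j + 1) $ i"
      using B K i j by (simp add: cols_mat_index)
    also have "\<dots> = (A *\<^sub>v w (j + 1)) $ i"
      unfolding BVK p using A B wj u i by (simp del: index_mult_mat_vec)
    finally show "col (A * (?V * H)) j $ i
        = col (B * (?V * ?K) - cols_mat N (inner_residual N A B \<sigma> v t w) m) j $ i"
      unfolding AVH by simp
  qed (use A in simp)
qed (use A B H K_mat_carrier[OF H, of \<sigma> t] in auto)

text \<open>Expanding both sides gives \<open>A V K\<close>, \<open>A V H\<close>, \<open>B V K\<close> and \<open>B V H\<close> applied to \<open>y\<close>; the coefficients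
  of the first and the last agree, and the remaining difference
  \<open>(\<mu> - s) (B V K - A V H) y\<close> is \<open>(\<mu> - s) P y\<close>. The first term on the right is the preconditioner
  applied to the computed residual.\<close>

lemma true_residual_decomposition:
  assumes A: "A \<in> carrier_mat N N" and B: "B \<in> carrier_mat N N"
    and V: "V \<in> carrier_mat N n" and H: "H \<in> carrier_mat n m" and K: "K \<in> carrier_mat n m"
    and P: "P \<in> carrier_mat N m" and rel: "A * (V * H) = B * (V * K) - P"
    and y: "y \<in> carrier_vec m"
    and e: "e \<in> carrier_vec N" and d: "(A - s \<cdot>\<^sub>m B) *\<^sub>v e = (d :: complex vec)"
  shows "d - (A - \<mu> \<cdot>\<^sub>m B) *\<^sub>v (V *\<^sub>v ((K - s \<cdot>\<^sub>m H) *\<^sub>v y))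
    = (A - s \<cdot>\<^sub>m B) *\<^sub>v (e - V *\<^sub>v ((K - \<mu> \<cdot>\<^sub>m H) *\<^sub>v y)) + (\<mu> - s) \<cdot>\<^sub>v (P *\<^sub>v y)"
proof -
  define h where "h = V *\<^sub>v (H *\<^sub>v y)"
  define k where "k = V *\<^sub>v (K *\<^sub>v y)"
  have hk: "h \<in> carrier_vec N" "k \<in> carrier_vec N"
    unfolding h_def k_def using V H K y by auto
  have V_pencil: "V *\<^sub>v ((K - c \<cdot>\<^sub>m H) *\<^sub>v y) = k - c \<cdot>\<^sub>v h" for c
  proof -
    have "V *\<^sub>v ((K - c \<cdot>\<^sub>m H) *\<^sub>v y) = V *\<^sub>v (K *\<^sub>v y - c \<cdot>\<^sub>v (H *\<^sub>v y))"
      using matrix_pencil_mult_vec[OF K H y] by simp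
    also have "\<dots> = k - c \<cdot>\<^sub>v h"
      unfolding h_def k_def using H K y
      by (simp add: mult_minus_distrib_mat_vec[OF V] mult_mat_vec[OF V])
    finally show ?thesis .
  qed
  have "A *\<^sub>v h = (A * (V * H)) *\<^sub>v y"
    unfolding h_def
    by (simp only: assoc_mult_mat_vec[OF A mult_carrier_mat[OF V H] y] assoc_mult_mat_vec[OF V H y])
  also have "\<dots> = (B * (V * K)) *\<^sub>v y - P *\<^sub>v y"
    unfolding rel using mult_carrier_mat[OF B mult_carrier_mat[OF V K]] P y
    by (rule minus_mult_distrib_mat_vec)
  also have "(B * (V * K)) *\<^sub>v y = B *\<^sub>v k"
    unfolding k_def
    by (simp only: assoc_mult_mat_vec[OF B mult_carrier_mat[OF V K] y] assoc_mult_mat_vec[OF V K y])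
  finally have Ah: "A *\<^sub>v h = B *\<^sub>v k - P *\<^sub>v y" .
  have AB: "(A - c \<cdot>\<^sub>m B) *\<^sub>v (k - c' \<cdot>\<^sub>v h)
      = A *\<^sub>v k - c' \<cdot>\<^sub>v (A *\<^sub>v h) - c \<cdot>\<^sub>v (B *\<^sub>v k - c' \<cdot>\<^sub>v (B *\<^sub>v h))" for c c'
    using hk A B
    by (simp add: matrix_pencil_mult_vec[of _ N N] mult_minus_distrib_mat_vec[of _ N N] mult_mat_vec[of _ N N])
  have S: "A - s \<cdot>\<^sub>m B \<in> carrier_mat N N"
    using B by (intro minus_carrier_mat smult_carrier_mat)
  have "(A - s \<cdot>\<^sub>m B) *\<^sub>v (e - (k - \<mu> \<cdot>\<^sub>v h)) = d - (A - s \<cdot>\<^sub>m B) *\<^sub>v (k - \<mu> \<cdot>\<^sub>v h)"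
    using mult_minus_distrib_mat_vec[OF S e, of "k - \<mu> \<cdot>\<^sub>v h"] hk d by simp
  moreover have dN: "d \<in> carrier_vec N" using S e d by auto
  ultimately show ?thesis
    unfolding V_pencil AB Ah
    by (intro eq_vecI)
      (use A B P hk y in \<open>auto simp: AB Ah algebra_simps simp del: index_mult_mat_vec\<close>)
qed

section \<open>The true residual and the computed residuals\<close>

text \<open>The computed residuals of all steps can be read off the final matrices. By the Hessenberg
  structure, the first \<open>k\<close> columns of \<open>K - \<mu> H\<close> vanish below row \<open>k\<close> (counted from \<open>0\<close>), so the residual
  of a padded vector lives in the first \<open>k + 1\<close> coordinates and there equals the reduced residual.
  For \<open>k = 0\<close> the padded vector is zero, which gives the starting residual.\<close>

lemma computed_residual_zero_padded:
  assumes H: "H \<in> carrier_mat (m + 1) m" and K: "K \<in> carrier_mat (m + 1) m"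
    and hess: "\<And>i j. i < m + 1 \<Longrightarrow> j + 1 < i \<Longrightarrow> H $$ (i, j) = 0 \<and> K $$ (i, j) = 0"
    and k: "k \<le> m" and u: "1 \<le> k \<Longrightarrow> yred k \<in> carrier_vec k"
    and v1: "v 1 \<in> carrier_vec N"
  shows "computed_residual N v \<beta> H K \<mu> yred k
    = cols_mat N v (m + 1) *\<^sub>v (complex_of_real \<beta> \<cdot>\<^sub>v unit_vec (m + 1) 0
        - (K - \<mu> \<cdot>\<^sub>m H) *\<^sub>v vec m (\<lambda>i. if i < k then yred k $ i else 0))"
    (is "_ = _ *\<^sub>v ?\<rho>")
proof -
  have \<rho>: "?\<rho> \<in> carrier_vec (m + 1)"
    using H by (intro carrier_vecI) simp
  have entry: "?\<rho> $ i = (if i = 0 then complex_of_real \<beta> else 0)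
      - (\<Sum>j<k. (K $$ (i, j) - \<mu> * H $$ (i, j)) * yred k $ j)" if i: "i < m + 1" for i
  proof -
    have "((K - \<mu> \<cdot>\<^sub>m H) *\<^sub>v vec m (\<lambda>i. if i < k then yred k $ i else 0)) $ i
        = (\<Sum>j<m. (K $$ (i, j) - \<mu> * H $$ (i, j)) * (if j < k then yred k $ j else 0))"
      using i H K by (auto simp: scalar_prod_def atLeast0LessThan intro!: sum.cong)
    also have "\<dots> = (\<Sum>j<k. (K $$ (i, j) - \<mu> * H $$ (i, j)) * yred k $ j)"
      using k by (intro sum.mono_neutral_cong_right) auto
    finally show ?thesis
      using i H K by (simp del: index_mult_mat_vec)
  qed
  have "cols_mat N v (m + 1) *\<^sub>v ?\<rho> = cols_mat N v (k + 1) *\<^sub>v vec (k + 1) (\<lambda>i. ?\<rho> $ i)"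
  proof (rule cols_mat_mult_truncate[OF \<rho>])
    fix i assume i: "k + 1 \<le> i" "i < m + 1"
    have "(\<Sum>j<k. (K $$ (i, j) - \<mu> * H $$ (i, j)) * yred k $ j) = 0"
      using i hess by (intro sum.neutral) auto
    then show "?\<rho> $ i = 0" unfolding entry[OF i(2)] using i by simp
  qed (use k in simp)
  also have "\<dots> = computed_residual N v \<beta> H K \<mu> yred k"
  proof (cases "k = 0")
    case True
    have "vec (k + 1) (\<lambda>i. ?\<rho> $ i) = complex_of_real \<beta> \<cdot>\<^sub>v unit_vec 1 0"
      using True entry[of 0]
      by (intro eq_vecI) (auto simp del: index_minus_vec index_mult_mat_vec)
    moreover have "cols_mat N v 1 *\<^sub>v (complex_of_real \<beta> \<cdot>\<^sub>v unit_vec 1 0) = complex_of_real \<beta> \<cdot>\<^sub>v v 1"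
      using v1 by (intro eq_vecI) (auto simp: cols_mat_mult_vec_index simp del: index_mult_mat_vec)
    ultimately show ?thesis using True by (simp add: computed_residual_def)
  next
    case False
    have "vec (k + 1) (\<lambda>i. ?\<rho> $ i) = reduced_residual \<beta> H K \<mu> k (yred k)"
    proof (rule eq_vecI)
      fix i assume "i < dim_vec (reduced_residual \<beta> H K \<mu> k (yred k))"
      then have i: "i < k + 1" by (simp add: reduced_residual_def leading_def)
      have "reduced_residual \<beta> H K \<mu> k (yred k) $ i = (if i = 0 then complex_of_real \<beta> else 0)
          - (\<Sum>j<k. (K $$ (i, j) - \<mu> * H $$ (i, j)) * yred k $ j)"
        using i u False
        by (auto simp: reduced_residual_def leading_def scalar_prod_def atLeast0LessThan intro!: sum.cong)
      then show "vec (k + 1) (\<lambda>i. ?\<rho> $ i) $ i = reduced_residual \<beta> H K \<mu> k (yred k) $ i"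
        using i k entry[of i] by simp
    qed (simp add: reduced_residual_def leading_def)
    then show ?thesis using False by (simp add: computed_residual_def)
  qed
  finally show ?thesis by simp
qed

theorem proposition4p1:
  fixes N m :: nat and A B H K :: "complex mat" and d :: "complex vec"
    and \<mu> :: complex and \<sigma> :: "nat \<Rightarrow> complex"
    and v t w yred r :: "nat \<Rightarrow> complex vec" and \<beta> \<epsilon> :: real
  assumes "\<epsilon> > 0" and "1 \<le> m"
    and "A \<in> carrier_mat N N" and "B \<in> carrier_mat N N" and "d \<in> carrier_vec N"
    and "invertible_mat (A - \<sigma> 0 \<cdot>\<^sub>m B)" and "\<mu> - \<sigma> 0 \<noteq> 0"
    and "inexact_LRK N m A B d \<sigma> v t w H"
    and "\<beta> = vnorm (precond_rhs A B (\<sigma> 0) d)"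
    and "K = K_mat m \<sigma> t H"
    and "\<forall>k\<in>{1..m}. is_arg_min (\<lambda>y. vnorm (reduced_residual \<beta> H K \<mu> k y))
                      (\<lambda>y. y \<in> carrier_vec k) (yred k)"
    and "\<And>k. r k = computed_residual N v \<beta> H K \<mu> yred k"
    and "\<forall>k\<in>{1..m}. vnorm (r (k - 1)) \<noteq> 0"
    and "\<forall>k\<in>{1..m}. vnorm (inner_residual N A B \<sigma> v t w k)
           \<le> 1 / cmod (\<mu> - \<sigma> 0) * (sval_min (K - \<mu> \<cdot>\<^sub>m H) / real m) * (\<epsilon> / vnorm (r (k - 1)))"
  shows "vnorm (d - (A - \<mu> \<cdot>\<^sub>m B) *\<^sub>v approx_solution N m v H K (\<sigma> 0) (yred m))
           \<le> vnorm ((A - \<sigma> 0 \<cdot>\<^sub>m B) *\<^sub>v r m) + \<epsilon>"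
proof -
  note [simp del] = index_mult_mat_vec
  let ?S = "A - \<sigma> 0 \<cdot>\<^sub>m B" and ?V = "cols_mat N v (m + 1)" and ?M = "K - \<mu> \<cdot>\<^sub>m H"
  let ?p = "inner_residual N A B \<sigma> v t w"
  define e where "e = precond_rhs A B (\<sigma> 0) d"
  define b where "b = complex_of_real \<beta> \<cdot>\<^sub>v unit_vec (m + 1) 0"
  define y where "y = yred m"
  \<comment> \<open>The least-squares solution of step \<open>k\<close> as a competitor in step \<open>m\<close>.\<close>
  define pad where "pad k = vec m (\<lambda>i. if i < k then yred k $ i else 0)" for k
  note A = assms(3) and B = assms(4)
  have \<beta>: "\<beta> = vnorm e" "\<beta> \<noteq> 0" and v1: "v 1 = complex_of_real (1 / \<beta>) \<cdot>\<^sub>v e"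
    and v: "\<And>k. k \<in> {1..m + 1} \<Longrightarrow> v k \<in> carrier_vec N"
    and t: "\<And>k. k \<in> {1..m} \<Longrightarrow> t k \<in> carrier_vec k"
    and w: "\<And>k. k \<in> {1..m} \<Longrightarrow> w k \<in> carrier_vec N"
    and orth: "mat_adjoint ?V * ?V = 1\<^sub>m (m + 1)"
    and H: "H \<in> carrier_mat (m + 1) m"
    and hess: "\<And>i j. i < m + 1 \<Longrightarrow> j + 1 < i \<Longrightarrow> H $$ (i, j) = 0"
    and W: "cols_mat N w m = ?V * H"
    using assms(8,9) by (auto simp: inexact_LRK_def Let_def e_def)
  have K: "K \<in> carrier_mat (m + 1) m" using K_mat_carrier[OF H] assms(10) by simp
  have M: "?M \<in> carrier_mat (m + 1) m"
    using H by (intro minus_carrier_mat smult_carrier_mat)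
  have hessK: "K $$ (i, j) = 0" if "i < m + 1" "j + 1 < i" for i j
    using that hess[OF that] by (simp add: assms(10) K_mat_index[OF H])
  have e: "e \<in> carrier_vec N" "?S *\<^sub>v e = d"
    unfolding e_def precond_rhs_def
    using mat_inverse_solves[OF minus_carrier_mat[OF smult_carrier_mat[OF B]] assms(6,5)] by auto
  have b: "b \<in> carrier_vec (m + 1)" by (simp add: b_def)
  have yred: "yred k \<in> carrier_vec k" if "k \<in> {1..m}" for k
    using assms(11) that by (simp add: is_arg_min_def)
  then have y: "y \<in> carrier_vec m" using assms(2) by (simp add: y_def)
  have pad: "pad k \<in> carrier_vec m" for k by (simp add: pad_def)
  have r: "r k = ?V *\<^sub>v (b - ?M *\<^sub>v pad k)" if "k \<le> m" for k
    unfolding assms(12) b_def pad_def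
    using H K _ that by (rule computed_residual_zero_padded) (use hess hessK yred v that in auto)
  have norm_r: "vnorm (r k) = vnorm (b - ?M *\<^sub>v pad k)" if "k \<le> m" for k
    unfolding r[OF that] using orth M b
    by (intro vnorm_isometry[of _ N "m + 1"]) (auto intro!: carrier_vecI)
  have pad_m: "pad m = y" using y by (auto simp: pad_def y_def[symmetric])
  have lead: "leading m X = X" if "X \<in> carrier_mat (m + 1) m" for X
    using that by (auto simp: leading_def)
  have min: "vnorm (b - ?M *\<^sub>v y) \<le> vnorm (b - ?M *\<^sub>v y')" if "y' \<in> carrier_vec m" for y'
    using bspec[OF assms(11), of m] assms(2) that
    by (auto simp: is_arg_min_def reduced_residual_def lead[OF H] lead[OF K] b_def y_def not_less)
  \<comment> \<open>The entry with index \<open>j\<close> belongs to iteration \<open>j + 1\<close>, whence \<open>r j\<close> and not \<open>r (j + 1)\<close>.\<close>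
  have entry: "sval_min ?M * cmod (y $ j) \<le> vnorm (r j)" if "j < m" for j
    using minimizer_entry_bound[OF M b y pad min that, of j] norm_r[of j] that
    by (simp add: pad_def)
  have "?V *\<^sub>v b = complex_of_real \<beta> \<cdot>\<^sub>v v 1"
    using v[of 1]
    by (intro eq_vecI) (auto simp: b_def cols_mat_mult_vec_index if_distrib sum.delta cong: if_cong)
  also have "\<dots> = e" using \<beta>(2) v1 by (simp add: smult_smult_assoc)
  finally have Vb: "?V *\<^sub>v b = e" .
  have rm: "r m = e - ?V *\<^sub>v (?M *\<^sub>v y)"
    using r[of m] M b y mult_minus_distrib_mat_vec[OF cols_mat_carrier b, of "?M *\<^sub>v y" N v]
    by (simp add: pad_m Vb[simplified])
  define q where "q = cols_mat N ?p m *\<^sub>v y"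
  have q: "q \<in> carrier_vec N" unfolding q_def using cols_mat_carrier y by (rule mult_mat_vec_carrier)
  have "d - (A - \<mu> \<cdot>\<^sub>m B) *\<^sub>v approx_solution N m v H K (\<sigma> 0) y = ?S *\<^sub>v r m + (\<mu> - \<sigma> 0) \<cdot>\<^sub>v q"
    unfolding approx_solution_def rm q_def
    using inexact_rational_Krylov_relation[OF A B H t w W, of \<sigma>, folded assms(10)]
    by (intro true_residual_decomposition[OF A B cols_mat_carrier H K cols_mat_carrier _ y e])
  also have "vnorm \<dots> \<le> vnorm (?S *\<^sub>v r m) + cmod (\<mu> - \<sigma> 0) * vnorm q"
    unfolding vnorm_smult[symmetric] using A B q
    by (intro vnorm_triangle[of _ N]) (auto intro!: carrier_vecI)
  also have "cmod (\<mu> - \<sigma> 0) * vnorm q \<le> \<epsilon>"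
  proof -
    have p: "vec N (\<lambda>i. ?p (j + 1) $ i) = ?p (j + 1)" if "j < m" for j
      using A B w[of "j + 1"] that
      by (intro eq_vecI) (auto simp: inner_residual_def)
    have "cmod (\<mu> - \<sigma> 0) * (cmod (y $ j) * vnorm (?p (j + 1))) \<le> \<epsilon> / m" if j: "j < m" for j
    proof -
      have r0: "vnorm (r j) > 0"
        using bspec[OF assms(13), of "j + 1"] j vnorm_nonneg[of "r j"] by simp
      have \<mu>: "cmod (\<mu> - \<sigma> 0) > 0" using assms(7) by simp
      have "vnorm (?p (j + 1)) \<le> 1 / cmod (\<mu> - \<sigma> 0) * (sval_min ?M / real m) * (\<epsilon> / vnorm (r j))"
        using bspec[OF assms(14), of "j + 1"] j by simp
      then have "cmod (\<mu> - \<sigma> 0) * (cmod (y $ j) * vnorm (?p (j + 1)))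
          \<le> cmod (\<mu> - \<sigma> 0) * (cmod (y $ j)
              * (1 / cmod (\<mu> - \<sigma> 0) * (sval_min ?M / real m) * (\<epsilon> / vnorm (r j))))"
        by (intro mult_left_mono) auto
      also have "\<dots> = (sval_min ?M * cmod (y $ j)) * (\<epsilon> / (m * vnorm (r j)))"
        using \<mu> by (simp add: field_simps)
      also have "\<dots> \<le> vnorm (r j) * (\<epsilon> / (m * vnorm (r j)))"
        using assms(1) r0 by (intro mult_right_mono entry j) auto
      also have "\<dots> = \<epsilon> / m" using r0 by simp
      finally show ?thesis .
    qed
    then have "(\<Sum>j<m. cmod (\<mu> - \<sigma> 0) * (cmod (y $ j) * vnorm (?p (j + 1)))) \<le> (\<Sum>j<m. \<epsilon> / m)"
      by (intro sum_mono) simp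
    moreover have "cmod (\<mu> - \<sigma> 0) * vnorm q
        \<le> (\<Sum>j<m. cmod (\<mu> - \<sigma> 0) * (cmod (y $ j) * vnorm (?p (j + 1))))"
      using mult_left_mono[OF vnorm_cols_mat_mult_le[OF y, of N ?p], of "cmod (\<mu> - \<sigma> 0)"] p
      by (simp add: q_def sum_distrib_left)
    ultimately show ?thesis using assms(2) by simp
  qed
  finally show ?thesis by (simp add: y_def)
qed

end
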